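(* Let $G,H$ be impartial games with $\mathbf N\notin o(H)$. Then $o(G+H)\subseteq o(G)$.
   Context: All games are short impartial games (identified with the finite set of their options, no infinite runs); $G+H$ is the disjunctive sum. There are $N\ge 2$ players moving cyclically; under normal play the player unable to move on their turn is the unique loser. Relative to a position, the players are $\mathbf N=\mathbf O_0$ (next to move), $\mathbf O_1,\dots,\mathbf O_{N-2}$, $\mathbf P=\mathbf O_{N-1}$, where $\mathbf O_i$ moves $i$ turns after $\mathbf N$. The outcome $o(G)\subseteq\{\mathbf O_0,\dots,\mathbf O_{N-1}\}$ is defined recursively: $\mathbf N\in o(G)$ iff some option $G'$ has $\mathbf P\in o(G')$; for $1\le i\le N-1$, $\mathbf O_i\in o(G)$ iff every option $G'$ has $\mathbf O_{i-1}\in o(G')$. *)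

theory Defs
  imports Main "HOL-Library.FSet"
begin

datatype game = Game (opts: "game fset")

lemma size_opts: "G' |\<in>| opts G \<Longrightarrow> size G' < size G"
proof (cases G)
  case (Game A)
  assume "G' |\<in>| opts G"
  then have "(Suc \<circ> size) G' \<le> (\<Sum>x\<in>fset A. (Suc \<circ> size) x)"
    using Game by (intro member_le_sum) auto
  then show ?thesis using Game by (simp add: size_fset_simps)
qed

text \<open>Disjunctive sum: a move is a move in exactly one of the two components.\<close>

function game_sum :: "game \<Rightarrow> game \<Rightarrow> game" (infixl "\<oplus>" 65) where
  "G \<oplus> H = Game ((\<lambda>G'. G' \<oplus> H) |`| opts G |\<union>| (\<lambda>H'. G \<oplus> H') |`| opts H)"
  by pat_completeness auto
termination
  by (relation "measure (\<lambda>(G, H). size G + size H)") (auto dest: size_opts)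

text \<open>
  \<open>outcome N G\<close> is the outcome of \<open>G\<close> for \<open>N\<close> players. The player who moves \<open>i\<close> turns after
  the next player is represented by the number \<open>i < N\<close>, so that the next player is \<open>0\<close> and
  the previous player is \<open>N - 1\<close>.
\<close>

function outcome :: "nat \<Rightarrow> game \<Rightarrow> nat set" where
  "outcome N G =
     {i. i < N \<and>
         (if i = 0 then \<exists>G' |\<in>| opts G. N - 1 \<in> outcome N G'
          else \<forall>G' |\<in>| opts G. i - 1 \<in> outcome N G')}"
  by pat_completeness auto
termination
  by (relation "measure (\<lambda>(N, G). size G)") (auto dest: size_opts)

declare game_sum.simps [simp del] outcome.simps [simp del]

end

theory Submission
  imports Defs
begin

text \<open>
  Membership of \<open>i\<close> in the outcome means that player \<open>i\<close> can avoid losing against the coalition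
  of all the others. If the next player has a good move in \<open>G \<oplus> H\<close> inside \<open>G\<close>, induction
  applies directly. If the good move is to some \<open>G \<oplus> H'\<close>, then the others answer in \<open>H'\<close> only,
  refuting the move there; after one full round the same player is to move in \<open>G \<oplus> K\<close>, where
  \<open>K\<close> is smaller than \<open>H\<close> and still lost for the next player, and induction applies again.
\<close>

lemma opts_game_sum:
  "opts (G \<oplus> H) = (\<lambda>G'. G' \<oplus> H) |`| opts G |\<union>| (\<lambda>H'. G \<oplus> H') |`| opts H"
  by (subst game_sum.simps) simp

lemma zero_in_outcome_iff:
  "0 \<in> outcome N G \<longleftrightarrow> 0 < N \<and> (\<exists>G' |\<in>| opts G. N - 1 \<in> outcome N G')"
  by (subst outcome.simps) simp

lemma Suc_in_outcome_iff:
  "Suc i \<in> outcome N G \<longleftrightarrow> Suc i < N \<and> (\<forall>G' |\<in>| opts G. i \<in> outcome N G')"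
  by (subst outcome.simps) simp

text \<open>The \<open>i\<close> players moving before player \<open>i\<close> each choose an option
  of \<open>H\<close> that refutes this player. The size bound is weak because \<open>i = 0\<close>
  gives \<open>K = H\<close>.\<close>

lemma coalition_plays_in_right_summand:
  assumes "i \<in> outcome N (G \<oplus> H)" and "i \<notin> outcome N H"
  obtains K where "size K \<le> size H" "0 \<in> outcome N (G \<oplus> K)" "0 \<notin> outcome N K"
  using assms
proof (induction i arbitrary: H thesis)
  case 0
  then show ?case by blast
next
  case (Suc i)
  \<comment> \<open>The first assumption gives \<open>Suc i < N\<close>, so the failure in
    \<open>H\<close> comes from an option.\<close>
  then obtain H' where H': "H' |\<in>| opts H" "i \<notin> outcome N H'"
    by (auto simp: Suc_in_outcome_iff)
  then have "i \<in> outcome N (G \<oplus> H')"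
    using Suc.prems(2) by (auto simp: Suc_in_outcome_iff opts_game_sum)
  then obtain K where "size K \<le> size H'" "0 \<in> outcome N (G \<oplus> K)" "0 \<notin> outcome N K"
    using Suc.IH H'(2) by blast
  then show ?case
    using Suc.prems(1)[of K] size_opts[OF H'(1)] by simp
qed

lemma in_outcome_of_in_outcome_sum:
  assumes "i \<in> outcome N (G \<oplus> H)" and "0 \<notin> outcome N H"
  shows "i \<in> outcome N G"
  using assms
proof (induction "size G + size H" arbitrary: i G H rule: less_induct)
  case less
  have IH_left: "j \<in> outcome N G'"
    if "G' |\<in>| opts G" "j \<in> outcome N (G' \<oplus> H)" for j G'
    using less.hyps[of G' H j] less.prems(2) that size_opts by simp
  show ?case
  proof (cases i)
    case 0
    with less.prems(1) consider
        G' where "G' |\<in>| opts G" "N - 1 \<in> outcome N (G' \<oplus> H)"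
      | H' where "H' |\<in>| opts H" "N - 1 \<in> outcome N (G \<oplus> H')"
      by (auto simp: zero_in_outcome_iff opts_game_sum)
    then show ?thesis
    proof cases
      case 1
      then show ?thesis
        using IH_left less.prems(1) 0 by (auto simp: zero_in_outcome_iff)
    next
      case 2
      then have "N - 1 \<notin> outcome N H'"
        using less.prems 0 by (auto simp: zero_in_outcome_iff)
      with 2(2) obtain K where K: "size K \<le> size H'" "0 \<in> outcome N (G \<oplus> K)" "0 \<notin> outcome N K"
        by (rule coalition_plays_in_right_summand)
      \<comment> \<open>The move to \<open>H'\<close> makes \<open>K\<close> strictly smaller than
        \<open>H\<close>, so the measure drops although \<open>G\<close> is unchanged.\<close>
      with size_opts[OF 2(1)] show ?thesis
        using less.hyps[of G K 0] 0 by simp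
    qed
  next
    case (Suc j)
    then show ?thesis
      using IH_left less.prems(1) by (auto simp: Suc_in_outcome_iff opts_game_sum)
  qed
qed

theorem mainTheorem4:
  fixes N :: nat and G H :: game
  assumes "N \<ge> 2" and "0 \<notin> outcome N H"
  shows "outcome N (G \<oplus> H) \<subseteq> outcome N G"
  using in_outcome_of_in_outcome_sum assms(2) by blast

end
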